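(* Let $\psi(t)=\sum_{p\ge 0} w_p t^p$ be the formal power series in which $w_p$ is the number of Wicketed Ferrers diagrams of half-perimeter $p$ (as defined in the context). Then $\psi$ satisfies the quadratic equation $$(2 t-1)^8 \psi^2 -t^6 (2 t-1)^4 \psi + t^{14} = 0.$$
   Context: A Ferrers diagram (in this convention) is a finite collection of rows of unit square cells stacked vertically, numbered from bottom to top, all rows left-aligned (row $i$ occupies columns $1,\dots,m_i$), with row lengths $1\le m_1\le m_2\le\cdots$ nondecreasing upward. Its half-perimeter is (top width) + (number of rows). A Wicketed Ferrers diagram is a Ferrers diagram from which another Ferrers diagram (same conventions) is removed from the interior, forming a hole (the wicket). Precisely, it is given by integers $1\le j<n<N$, an integer $\ell\ge1$, integers $m_1,\dots,m_N$ and $g_{j+1},\dots,g_n$ such that: for $i\le j$ and for $n<i\le N$, row $i$ is a full row occupying columns $1,\dots,m_i$; for $j<i\le n$, row $i$ occupies columns $1,\dots,\ell$ and columns $g_i+1,\dots,m_i$, the columns $\ell+1,\dots,g_i$ being empty, where $\ell<g_i<m_i$; moreover $g_{j+1}<m_j$, and for $j<i<n$: $g_i\le g_{i+1}<m_i$; and $m_1\le m_2\le\dots\le m_N$. (Thus the removed cells form a left-aligned Ferrers shape lying strictly inside the diagram, covered below by row $j$ and above by the full row $n+1$.) Its half-perimeter is half the total boundary length of the union of its cells, counting both the outer boundary and the boundary of the hole; this equals $m_N+N+(n-j)+(g_n-\ell)$. *)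

theory Defs
  imports "HOL-Computational_Algebra.Formal_Power_Series"
begin

text \<open>
  A cell is the pair of its column (growing to the right) and its row (growing upwards), so the
  four neighbours of every cell are again pairs of integers.
\<close>

type_synonym cell = "int \<times> int"

definition adjacent :: "cell \<Rightarrow> cell \<Rightarrow> bool" where
  "adjacent c d \<longleftrightarrow> \<bar>fst c - fst d\<bar> + \<bar>snd c - snd d\<bar> = 1"

text \<open>
  A unit edge lies on the boundary of the union of the (closed) cells of \<open>D\<close> iff it separates
  a cell of \<open>D\<close> from a cell outside \<open>D\<close>; hence boundary edges are counted by such pairs.
  This includes the boundaries of holes.
\<close>

definition boundary_length :: "cell set \<Rightarrow> nat" where
  "boundary_length D = card {(c, d). c \<in> D \<and> d \<notin> D \<and> adjacent c d}"

definition half_perimeter :: "cell set \<Rightarrow> real" where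
  "half_perimeter D = real (boundary_length D) / 2"

definition wicketed_cells ::
  "int \<Rightarrow> int \<Rightarrow> int \<Rightarrow> int \<Rightarrow> (int \<Rightarrow> int) \<Rightarrow> (int \<Rightarrow> int) \<Rightarrow> cell set" where
  "wicketed_cells j n N l m g =
     {(x, i). 1 \<le> i \<and> i \<le> N \<and>
        (if j < i \<and> i \<le> n then x \<in> {1..l} \<union> {g i + 1..m i} else x \<in> {1..m i})}"

text \<open>
  Diagrams are identified with their sets of cells. The values of \<open>m\<close> outside \<open>{1..N}\<close> and of
  \<open>g\<close> outside \<open>{j+1..n}\<close> are irrelevant, and the remaining data can be read off the cells.
  The condition \<open>1 \<le> m 1\<close> says that the rows are nonempty.
\<close>

definition wicketed_ferrers :: "cell set \<Rightarrow> bool" where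
  "wicketed_ferrers D \<longleftrightarrow>
     (\<exists>j n N l m g.
        1 \<le> j \<and> j < n \<and> n < N \<and> 1 \<le> l \<and>
        1 \<le> m 1 \<and> (\<forall>i. 1 \<le> i \<and> i < N \<longrightarrow> m i \<le> m (i + 1)) \<and>
        (\<forall>i. j < i \<and> i \<le> n \<longrightarrow> l < g i \<and> g i < m i) \<and>
        g (j + 1) < m j \<and>
        (\<forall>i. j < i \<and> i < n \<longrightarrow> g i \<le> g (i + 1) \<and> g (i + 1) < m i) \<and>
        D = wicketed_cells j n N l m g)"

definition wicketed_count :: "nat \<Rightarrow> nat" where
  "wicketed_count p = card {D. wicketed_ferrers D \<and> half_perimeter D = real p}"

definition wicketed_gf :: "int fps" where
  "wicketed_gf = Abs_fps (\<lambda>p. int (wicketed_count p))"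

end

theory Submission
  imports Defs
begin

text \<open>
  Read a diagram row by row from the bottom. The rows allowed above a given row, and the increase of
  the half-perimeter, depend only on that row, so diagrams are walks in an infinite weighted graph,
  and the generating functions of the walks from each vertex form the unique solution of a linear
  system. For a holed row only the distance \<open>d\<close> from the hole to the right border matters. With
  \<open>c = 1 / (1 - 2 X)\<close> and \<open>\<lambda> = X + X \<lambda>\<^sup>2\<close> (a Catalan series), the powers \<open>\<lambda> ^ d\<close> solve the homogeneous
  equation, which gives \<open>X c\<^sup>2 ((1 - X)\<^sup>2 - X\<^sup>2 \<lambda> ^ d)\<close> for the walks from such a row. Solving for the
  full rows below the hole in the same way gives \<open>\<psi> = X ^ 7 \<lambda> c ^ 4\<close>, and the claim is the
  quadratic equation of \<open>\<lambda>\<close>.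
\<close>

unbundle fps_syntax

section \<open>Counting walks by cost\<close>

fun walk :: "('a \<Rightarrow> 'a \<Rightarrow> bool) \<Rightarrow> ('a \<Rightarrow> bool) \<Rightarrow> 'a \<Rightarrow> 'a list \<Rightarrow> bool" where
  "walk step final s [] \<longleftrightarrow> final s"
| "walk step final s (r # rs) \<longleftrightarrow> step s r \<and> walk step final r rs"

fun walk_cost :: "('a \<Rightarrow> 'a \<Rightarrow> nat) \<Rightarrow> 'a \<Rightarrow> 'a list \<Rightarrow> nat" where
  "walk_cost cost s [] = 0"
| "walk_cost cost s (r # rs) = cost s r + walk_cost cost r rs"

text \<open>Passes between walks and rows given by an index, as in the data \<open>m\<close> and
  \<open>g\<close> of a diagram.\<close>

lemma walk_iff_nth:
  "walk step final s rs \<longleftrightarrow>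
     (\<forall>i<length rs. step ((s # rs) ! i) (rs ! i)) \<and> final ((s # rs) ! length rs)"
proof (induction rs arbitrary: s)
  case (Cons r rs)
  show ?case
    by (auto simp: Cons.IH less_Suc_eq_0_disj nth_Cons' split: if_splits)
qed simp

text \<open>Split off the first step and use strong induction on \<open>p\<close>: every step has
  positive cost, so the rest of the walk is cheaper. Finiteness is proved along with the count
  because the cardinality of the union needs it.\<close>

lemma card_walks_eq_fps_nth:
  fixes V :: "'a \<Rightarrow> int fps"
  assumes closed: "\<And>s r. s \<in> S \<Longrightarrow> step s r \<Longrightarrow> r \<in> S"
    and pos: "\<And>s r. s \<in> S \<Longrightarrow> step s r \<Longrightarrow> 0 < cost s r"
    and fin: "\<And>s p. s \<in> S \<Longrightarrow> finite {r. step s r \<and> cost s r \<le> p}"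
    and rec: "\<And>s p. s \<in> S \<Longrightarrow> V s $ p =
      of_bool (final s \<and> p = 0) + (\<Sum>r | step s r \<and> cost s r \<le> p. V r $ (p - cost s r))"
    and "s \<in> S"
  shows "finite {rs. walk step final s rs \<and> walk_cost cost s rs = p} \<and>
    int (card {rs. walk step final s rs \<and> walk_cost cost s rs = p}) = V s $ p"
  using \<open>s \<in> S\<close>
proof (induction p arbitrary: s rule: less_induct)
  case (less p)
  define W where "W s p = {rs. walk step final s rs \<and> walk_cost cost s rs = p}" for s p
  define R where "R = {r. step s r \<and> cost s r \<le> p}"
  define E where "E = {rs :: 'a list. rs = [] \<and> final s \<and> p = 0}"
  have finR: "finite R"
    using fin less.prems by (simp add: R_def)
  have IH: "finite (W r (p - cost s r))" "int (card (W r (p - cost s r))) = V r $ (p - cost s r)"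
    if "r \<in> R" for r
  proof -
    have "p - cost s r < p" "r \<in> S"
      using that pos[OF less.prems, of r] closed[OF less.prems, of r] by (auto simp: R_def)
    then show "finite (W r (p - cost s r))" "int (card (W r (p - cost s r))) = V r $ (p - cost s r)"
      using less.IH by (auto simp: W_def)
  qed
  have decomp: "W s p = E \<union> (\<Union>r\<in>R. (#) r ` W r (p - cost s r))" (is "?L = ?R")
  proof (intro set_eqI iffI)
    fix rs assume "rs \<in> ?L"
    then show "rs \<in> ?R"
      by (cases rs) (auto simp: W_def R_def E_def)
  qed (auto simp: W_def R_def E_def)
  have "finite E"
    by (rule finite_subset[of _ "{[]}"]) (auto simp: E_def)
  have cardE: "card E = of_bool (final s \<and> p = 0)"
    by (cases "final s \<and> p = 0") (auto simp: E_def)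
  have fin_un: "finite (\<Union>r\<in>R. (#) r ` W r (p - cost s r))"
    using finR IH by auto
  have "card (W s p) = card E + card (\<Union>r\<in>R. (#) r ` W r (p - cost s r))"
    unfolding decomp by (rule card_Un_disjoint) (use fin_un \<open>finite E\<close> in \<open>auto simp: E_def\<close>)
  also have "card (\<Union>r\<in>R. (#) r ` W r (p - cost s r))
      = (\<Sum>r\<in>R. card ((#) r ` W r (p - cost s r)))"
    by (rule card_UN_disjoint) (use finR IH in auto)
  also have "\<dots> = (\<Sum>r\<in>R. card (W r (p - cost s r)))"
    by (intro sum.cong refl card_image) auto
  finally have "int (card (W s p))
      = of_bool (final s \<and> p = 0) + (\<Sum>r\<in>R. int (card (W r (p - cost s r))))"
    by (simp add: cardE)
  also have "\<dots> = V s $ p"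
    using IH by (simp add: rec[OF less.prems] R_def)
  finally show ?case
    using fin_un \<open>finite E\<close> decomp by (auto simp: W_def)
qed

section \<open>The generating functions\<close>

text \<open>The series \<open>\<Sum>b. X ^ b * f (k + b)\<close>.\<close>

definition shift_sum :: "(nat \<Rightarrow> int fps) \<Rightarrow> nat \<Rightarrow> int fps" where
  "shift_sum f k = Abs_fps (\<lambda>p. \<Sum>b\<le>p. f (k + b) $ (p - b))"

text \<open>The factor \<open>fps_X\<close> ties coefficient \<open>p\<close> of \<open>F k\<close>
  to coefficient \<open>p - 1\<close> of \<open>F (Suc k)\<close>, so the recurrence has only one
  solution. This verifies guessed closed forms; \<open>k0\<close> admits those that contain
  truncated differences such as \<open>M - G\<close>.\<close>

lemma shift_sum_unique:
  assumes "\<And>k. k0 \<le> k \<Longrightarrow> F k = f k + fps_X * F (Suc k)" and "k0 \<le> k"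
  shows "shift_sum f k = F k"
proof -
  have "F k $ p = (\<Sum>b\<le>p. f (k + b) $ (p - b))" if "k0 \<le> k" for p k
    using that
  proof (induction p arbitrary: k)
    case 0
    then show ?case
      by (subst assms(1)) auto
  next
    case (Suc p)
    then have "F k $ Suc p = f k $ Suc p + (\<Sum>b\<le>p. f (Suc k + b) $ (p - b))"
      by (subst assms(1)) (auto simp: Suc.IH)
    then show ?case
      by (simp add: sum.atMost_Suc_shift del: sum.atMost_Suc)
  qed
  then show ?thesis
    using assms(2) by (auto simp: shift_sum_def fps_eq_iff)
qed

text \<open>For a step between rows, \<open>b\<close> is the increase in width and \<open>n\<close>
  the rest of its cost, so the sum runs over the steps that cost at most \<open>p\<close>.\<close>

lemma fps_nth_X_power_times_shift_sum:
  "(fps_X ^ n * shift_sum f k) $ p = (\<Sum>b | n + b \<le> p. f (k + b) $ (p - (n + b)))"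
proof (cases "n \<le> p")
  case True
  then have "{b. n + b \<le> p} = {..p - n}"
    by auto
  with True show ?thesis
    by (simp add: fps_X_power_mult_nth shift_sum_def)
next
  case False
  then have "{b. n + b \<le> p} = {}"
    by auto
  with False show ?thesis
    by (simp add: fps_X_power_mult_nth)
qed

definition two_power_fps :: "int fps" where
  "two_power_fps = Abs_fps (\<lambda>n. 2 ^ n)"

lemma two_power_fps_eq: "two_power_fps = 1 + 2 * fps_X * two_power_fps"
proof (rule fps_ext)
  fix n
  show "two_power_fps $ n = (1 + 2 * fps_X * two_power_fps) $ n"
    by (cases n) (simp_all add: two_power_fps_def mult.assoc numeral_fps_const)
qed

text \<open>Coefficients of \<open>X * C (X\<^sup>2)\<close>, where \<open>C\<close> is the Catalan series.\<close>

fun catalan_coeff :: "nat \<Rightarrow> int" where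
  "catalan_coeff 0 = 0"
| "catalan_coeff (Suc n) = of_bool (n = 0) + (\<Sum>i\<le>n. catalan_coeff i * catalan_coeff (n - i))"

definition catalan_fps :: "int fps" where
  "catalan_fps = Abs_fps catalan_coeff"

lemma catalan_fps_eq: "catalan_fps = fps_X + fps_X * catalan_fps\<^sup>2"
proof (rule fps_ext)
  fix n
  have "catalan_fps\<^sup>2 $ k = (\<Sum>i\<le>k. catalan_coeff i * catalan_coeff (k - i))" for k
    by (simp add: catalan_fps_def power2_eq_square fps_mult_nth atLeast0AtMost)
  then show "catalan_fps $ n = (fps_X + fps_X * catalan_fps\<^sup>2) $ n"
    by (cases n) (auto simp: catalan_fps_def)
qed

section \<open>Rows of a diagram\<close>

text \<open>
  Full rows below and above the hole get different constructors, so that the rows allowed next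
  depend only on the current row. \<open>Holed l G M\<close> occupies the columns \<open>1..l\<close> and \<open>G + 1..M\<close>.
\<close>

datatype row = Lower nat | Holed nat nat nat | Upper nat

fun width :: "row \<Rightarrow> nat" where
  "width (Lower M) = M"
| "width (Holed l G M) = M"
| "width (Upper M) = M"

fun gap :: "row \<Rightarrow> nat" where
  "gap (Lower M) = 0"
| "gap (Holed l G M) = G - l"
| "gap (Upper M) = 0"

fun components :: "row \<Rightarrow> nat" where
  "components (Lower M) = 1"
| "components (Holed l G M) = 2"
| "components (Upper M) = 1"

text \<open>The last clause also forbids \<open>Lower\<close> to \<open>Upper\<close>, so a walk
  from a lower row to a final row must pass through a hole.\<close>

fun row_step :: "row \<Rightarrow> row \<Rightarrow> bool" where
  "row_step (Lower M) (Lower M') \<longleftrightarrow> M \<le> M'"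
| "row_step (Lower M) (Holed l G M') \<longleftrightarrow> 1 \<le> l \<and> l < G \<and> G < M \<and> M \<le> M'"
| "row_step (Holed l G M) (Holed l' G' M') \<longleftrightarrow> l' = l \<and> G \<le> G' \<and> G' < M \<and> M \<le> M'"
| "row_step (Holed l G M) (Upper M') \<longleftrightarrow> M \<le> M'"
| "row_step (Upper M) (Upper M') \<longleftrightarrow> M \<le> M'"
| "row_step _ _ \<longleftrightarrow> False"

fun is_upper :: "row \<Rightarrow> bool" where
  "is_upper (Upper M) \<longleftrightarrow> True"
| "is_upper _ \<longleftrightarrow> False"

text \<open>Truncated subtraction makes the step from a holed row to an upper row free of gap cost.\<close>

definition row_cost :: "row \<Rightarrow> row \<Rightarrow> nat" where
  "row_cost s r = components r + (width r - width s) + (gap r - gap s)"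

fun proper :: "row \<Rightarrow> bool" where
  "proper (Lower M) \<longleftrightarrow> 1 \<le> M"
| "proper (Holed l G M) \<longleftrightarrow> 1 \<le> l \<and> l < G \<and> G < M"
| "proper (Upper M) \<longleftrightarrow> 1 \<le> M"

lemma proper_row_step: "proper s \<Longrightarrow> row_step s r \<Longrightarrow> proper r"
  by (cases s; cases r) auto

text \<open>Up to the factor \<open>fps_X ^ 4 * two_power_fps\<^sup>2\<close> this is the
  \<open>shift_sum\<close> of the series of lower rows. It is a particular solution of their
  recurrence: the first two terms match the part linear in \<open>M\<close>, the last one matches
  the power of \<open>catalan_fps\<close>.\<close>

definition lower_gf :: "nat \<Rightarrow> int fps" where
  "lower_gf M = two_power_fps * (of_nat M - 2) + fps_X * catalan_fps * two_power_fps\<^sup>2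
     + two_power_fps * catalan_fps ^ (M - 1)"

fun row_gf :: "row \<Rightarrow> int fps" where
  "row_gf (Lower M) = fps_X ^ 4 * two_power_fps\<^sup>2 * (lower_gf M - fps_X * lower_gf (Suc M))"
| "row_gf (Holed l G M) =
     fps_X * two_power_fps\<^sup>2 * ((1 - fps_X)\<^sup>2 - fps_X\<^sup>2 * catalan_fps ^ (M - G))"
| "row_gf (Upper M) = (1 - fps_X) * two_power_fps"

section \<open>The closed forms solve the linear system\<close>

lemma shift_sum_row_gf_Upper: "shift_sum (\<lambda>M. row_gf (Upper M)) M = two_power_fps"
  by (rule shift_sum_unique[of M]) (auto simp: algebra_simps)

text \<open>The recurrence of \<open>shift_sum_unique\<close> holds because
  \<open>catalan_fps - fps_X * catalan_fps\<^sup>2\<close> equals \<open>fps_X\<close>.\<close>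

lemma shift_sum_row_gf_Holed:
  assumes "G \<le> M"
  shows "shift_sum (\<lambda>M. row_gf (Holed l G M)) M
    = fps_X * two_power_fps\<^sup>2 * ((1 - fps_X) - fps_X * catalan_fps ^ (Suc M - G))"
proof -
  define F where
    "F M = fps_X * two_power_fps\<^sup>2 * ((1 - fps_X) - fps_X * catalan_fps ^ (Suc M - G))" for M
  have "F k = row_gf (Holed l G k) + fps_X * F (Suc k)" if "G \<le> k" for k
  proof -
    define P where "P = catalan_fps ^ (k - G)"
    have P: "catalan_fps ^ (Suc k - G) = P * catalan_fps"
            "catalan_fps ^ (Suc (Suc k) - G) = P * catalan_fps\<^sup>2"
      using that by (auto simp: P_def Suc_diff_le power2_eq_square)
    show ?thesis
      unfolding F_def P row_gf.simps P_def[symmetric] using catalan_fps_eq by algebra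
  qed
  then have "shift_sum (\<lambda>M. row_gf (Holed l G M)) M = F M"
    using assms by (rule shift_sum_unique)
  then show ?thesis
    by (simp only: F_def)
qed

lemma shift_sum_row_gf_Lower:
  assumes "1 \<le> M"
  shows "shift_sum (\<lambda>M. row_gf (Lower M)) M = fps_X ^ 4 * two_power_fps\<^sup>2 * lower_gf M"
  by (rule shift_sum_unique[of 1]) (use assms in \<open>auto simp: algebra_simps\<close>)

text \<open>Removing the term \<open>a = 0\<close> from the sum for \<open>Suc d\<close> leaves
  \<open>fps_X\<close> times the sum for \<open>d\<close>; then
  \<open>fps_X + fps_X * catalan_fps\<^sup>2\<close> collapses to
  \<open>catalan_fps\<close>.\<close>

lemma sum_X_power_catalan:
  "(\<Sum>a<d. fps_X ^ a * ((1 - fps_X) - fps_X * catalan_fps ^ (Suc d - a))) = 1 - catalan_fps ^ d"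
proof (induction d)
  case (Suc d)
  define P where "P = catalan_fps ^ d"
  have "(\<Sum>a<Suc d. fps_X ^ a * ((1 - fps_X) - fps_X * catalan_fps ^ (Suc (Suc d) - a)))
    = (1 - fps_X) - fps_X * catalan_fps ^ Suc (Suc d)
      + fps_X * (\<Sum>a<d. fps_X ^ a * ((1 - fps_X) - fps_X * catalan_fps ^ (Suc d - a)))"
    unfolding sum.lessThan_Suc_shift sum_distrib_left by (simp add: mult.assoc)
  also have "\<dots> = 1 - catalan_fps ^ Suc d"
    unfolding Suc.IH power_Suc P_def[symmetric] using catalan_fps_eq by algebra
  finally show ?case .
qed simp

text \<open>Contribution of all steps from a holed row to a holed row, grouped by the new hole end
  \<open>G'\<close>. Putting \<open>a = G' - G\<close> reduces it to
  \<open>sum_X_power_catalan\<close>.\<close>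

lemma sum_hole_tops:
  "(\<Sum>G'\<in>{G..<M}. fps_X ^ (2 + (G' - G)) * shift_sum (\<lambda>M. row_gf (Holed l G' M)) M)
     = fps_X ^ 3 * two_power_fps\<^sup>2 * (1 - catalan_fps ^ (M - G))"
proof -
  have "(\<Sum>G'\<in>{G..<M}. fps_X ^ (2 + (G' - G)) * shift_sum (\<lambda>M. row_gf (Holed l G' M)) M)
    = (\<Sum>G'\<in>{G..<M}. fps_X ^ 3 * two_power_fps\<^sup>2 *
        (fps_X ^ (G' - G) * ((1 - fps_X) - fps_X * catalan_fps ^ (Suc M - G'))))"
    by (intro sum.cong refl, subst shift_sum_row_gf_Holed)
       (auto simp: power_add power2_eq_square power3_eq_cube mult_ac)
  also have "\<dots> = (\<Sum>a<M - G. fps_X ^ 3 * two_power_fps\<^sup>2 *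
        (fps_X ^ a * ((1 - fps_X) - fps_X * catalan_fps ^ (Suc (M - G) - a))))"
    by (rule sum.reindex_bij_witness[of _ "\<lambda>a. G + a" "\<lambda>G'. G' - G"])
       (auto simp: Suc_diff_le intro!: arg_cong2[of _ _ _ _ "(*)"] arg_cong2[of _ _ _ _ "(-)"]
          arg_cong2[of _ _ _ _ "(^)"])
  finally show ?thesis
    by (simp only: flip: sum_distrib_left add: sum_X_power_catalan)
qed

lemma row_gf_Upper: "row_gf (Upper M) = 1 + fps_X * shift_sum (\<lambda>M. row_gf (Upper M)) M"
  unfolding shift_sum_row_gf_Upper unfolding row_gf.simps using two_power_fps_eq by algebra

lemma row_gf_Holed:
  "row_gf (Holed l G M) = fps_X * shift_sum (\<lambda>M. row_gf (Upper M)) M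
     + (\<Sum>G'\<in>{G..<M}. fps_X ^ (2 + (G' - G)) * shift_sum (\<lambda>M. row_gf (Holed l G' M)) M)"
  unfolding sum_hole_tops shift_sum_row_gf_Upper unfolding row_gf.simps using two_power_fps_eq by algebra

text \<open>A geometric sum: \<open>two_power_fps * (1 - fps_X - fps_X * catalan_fps)\<close> is the
  inverse of \<open>1 - catalan_fps\<close>.\<close>

lemma sum_one_minus_catalan_power:
  "(\<Sum>k<n. 1 - catalan_fps ^ k)
     = of_nat n - two_power_fps * (1 - fps_X - fps_X * catalan_fps) * (1 - catalan_fps ^ n)"
proof (induction n)
  case (Suc n)
  define P where "P = catalan_fps ^ n"
  show ?case
    unfolding sum.lessThan_Suc Suc.IH power_Suc of_nat_Suc P_def[symmetric]
    using two_power_fps_eq catalan_fps_eq by algebra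
qed simp

text \<open>Opening a hole after column \<open>l\<close> is like a step from a holed row with hole
  end \<open>Suc l\<close>, with one more unit of gap to pay. So the inner sum is
  \<open>fps_X\<close> times \<open>sum_hole_tops\<close>, and the sum over \<open>l\<close> is
  geometric in \<open>k = M - Suc l\<close>.\<close>

lemma row_gf_Lower:
  assumes "1 \<le> M"
  shows "row_gf (Lower M) = fps_X * shift_sum (\<lambda>M. row_gf (Lower M)) M
     + (\<Sum>l\<in>{1..<M}. \<Sum>G\<in>{Suc l..<M}.
         fps_X ^ (2 + (G - l)) * shift_sum (\<lambda>M. row_gf (Holed l G M)) M)"
proof -
  have "(\<Sum>l\<in>{1..<M}. \<Sum>G\<in>{Suc l..<M}.
         fps_X ^ (2 + (G - l)) * shift_sum (\<lambda>M. row_gf (Holed l G M)) M)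
    = (\<Sum>l\<in>{1..<M}. fps_X * (fps_X ^ 3 * two_power_fps\<^sup>2 * (1 - catalan_fps ^ (M - Suc l))))"
  proof (intro sum.cong refl)
    fix l
    have "(\<Sum>G\<in>{Suc l..<M}. fps_X ^ (2 + (G - l)) * shift_sum (\<lambda>M. row_gf (Holed l G M)) M)
      = (\<Sum>G\<in>{Suc l..<M}.
          fps_X * (fps_X ^ (2 + (G - Suc l)) * shift_sum (\<lambda>M. row_gf (Holed l G M)) M))"
      by (intro sum.cong refl) (auto simp: mult.assoc Suc_diff_Suc simp flip: power_Suc)
    then show "(\<Sum>G\<in>{Suc l..<M}. fps_X ^ (2 + (G - l)) * shift_sum (\<lambda>M. row_gf (Holed l G M)) M)
      = fps_X * (fps_X ^ 3 * two_power_fps\<^sup>2 * (1 - catalan_fps ^ (M - Suc l)))"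
      by (simp only: flip: sum_distrib_left add: sum_hole_tops)
  qed
  also have "\<dots> = (\<Sum>k<M - 1. fps_X ^ 4 * two_power_fps\<^sup>2 * (1 - catalan_fps ^ k))"
    by (rule sum.reindex_bij_witness[of _ "\<lambda>k. M - Suc k" "\<lambda>l. M - Suc l"])
       (auto simp: numeral_eq_Suc mult_ac)
  also have "\<dots> = fps_X ^ 4 * two_power_fps\<^sup>2 * (of_nat (M - 1) -
      two_power_fps * (1 - fps_X - fps_X * catalan_fps) * (1 - catalan_fps ^ (M - 1)))"
    by (simp only: flip: sum_distrib_left add: sum_one_minus_catalan_power)
  finally have hole: "(\<Sum>l\<in>{1..<M}. \<Sum>G\<in>{Suc l..<M}.
         fps_X ^ (2 + (G - l)) * shift_sum (\<lambda>M. row_gf (Holed l G M)) M) = \<dots>" .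
  obtain k where k: "M = Suc k"
    using assms by (cases M) auto
  define P where "P = catalan_fps ^ k"
  have eq: "lower_gf M - fps_X * lower_gf (Suc M) = fps_X * lower_gf M + (of_nat (M - 1) -
      two_power_fps * (1 - fps_X - fps_X * catalan_fps) * (1 - catalan_fps ^ (M - 1)))"
    unfolding lower_gf_def k diff_Suc_1 power_Suc of_nat_Suc P_def[symmetric]
    using two_power_fps_eq catalan_fps_eq by algebra
  show ?thesis
    unfolding hole shift_sum_row_gf_Lower[OF assms] unfolding row_gf.simps eq by (simp add: algebra_simps)
qed

text \<open>The hypotheses \<open>fin\<close> and \<open>rec\<close> of
  \<open>card_walks_eq_fps_nth\<close>. The affordable steps are listed by the increase
  \<open>b\<close> in width and the position of the hole, which turns the sum over successors into
  coefficients of the \<open>shift_sum\<close> equations.\<close>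

lemma row_gf_nth:
  assumes "proper s"
  shows "finite {r. row_step s r \<and> row_cost s r \<le> p}"
    and "row_gf s $ p = of_bool (is_upper s \<and> p = 0)
      + (\<Sum>r | row_step s r \<and> row_cost s r \<le> p. row_gf r $ (p - row_cost s r))"
proof -
  have bnd: "finite {b. n + b \<le> p}" for n :: nat
    by (rule finite_subset[of _ "{..p}"]) auto
  have "finite {r. row_step s r \<and> row_cost s r \<le> p} \<and> row_gf s $ p = of_bool (is_upper s \<and> p = 0)
      + (\<Sum>r | row_step s r \<and> row_cost s r \<le> p. row_gf r $ (p - row_cost s r))"
  proof (cases s)
    case (Upper M)
    have steps: "{r. row_step s r \<and> row_cost s r \<le> p} = (\<lambda>b. Upper (M + b)) ` {b. 1 + b \<le> p}"
      (is "?R = ?S")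
    proof (intro set_eqI iffI)
      fix r assume "r \<in> ?R"
      then show "r \<in> ?S"
        by (cases r) (auto simp: Upper row_cost_def image_iff intro!: exI[of _ "width r - M"])
    qed (auto simp: Upper row_cost_def)
    have "(\<Sum>r\<in>?R. row_gf r $ (p - row_cost s r)) = (fps_X ^ 1 * shift_sum (\<lambda>M. row_gf (Upper M)) M) $ p"
      unfolding steps fps_nth_X_power_times_shift_sum
      by (subst sum.reindex) (auto simp: inj_on_def Upper row_cost_def simp del: row_gf.simps)
    moreover have "row_gf s = 1 + fps_X * shift_sum (\<lambda>M. row_gf (Upper M)) M"
      unfolding Upper by (rule row_gf_Upper)
    moreover have "finite ?R"
      unfolding steps using bnd by (rule finite_imageI)
    moreover have "is_upper s"
      by (simp add: Upper)
    ultimately show ?thesis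
      by (simp del: row_gf.simps)
  next
    case (Holed l G M)
    define A where "A = (\<lambda>b. Upper (M + b)) ` {b. 1 + b \<le> p}"
    define I where "I = (SIGMA G':{G..<M}. {b. (2 + (G' - G)) + b \<le> p})"
    define B where "B = (\<lambda>(G', b). Holed l G' (M + b)) ` I"
    have steps: "{r. row_step s r \<and> row_cost s r \<le> p} = A \<union> B" (is "?R = ?S")
    proof (intro set_eqI iffI)
      fix r assume r: "r \<in> ?R"
      show "r \<in> ?S"
      proof (cases r)
        case (Holed l' G' M')
        with r \<open>s = _\<close> assms have "r = (\<lambda>(G', b). Holed l G' (M + b)) (G', M' - M)" "(G', M' - M) \<in> I"
          by (auto simp: row_cost_def I_def)
        then show ?thesis
          unfolding B_def by blast
      next
        case (Upper M')
        with r Holed show ?thesis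
          by (auto simp: A_def row_cost_def image_iff intro!: exI[of _ "M' - M"])
      qed (use r Holed in auto)
    qed (use assms in \<open>auto simp: Holed A_def B_def I_def row_cost_def\<close>)
    have finI: "finite I"
      unfolding I_def by (intro finite_SigmaI bnd) simp
    have "(\<Sum>r\<in>A. row_gf r $ (p - row_cost s r)) = (fps_X ^ 1 * shift_sum (\<lambda>M. row_gf (Upper M)) M) $ p"
      unfolding A_def fps_nth_X_power_times_shift_sum
      by (subst sum.reindex) (auto simp: inj_on_def Holed row_cost_def simp del: row_gf.simps)
    \<comment> \<open>As \<open>l < G\<close> and \<open>G \<le> G'\<close>, the truncated
      difference of the two gaps is exactly \<open>G' - G\<close>.\<close>
    moreover have "(\<Sum>r\<in>B. row_gf r $ (p - row_cost s r))
      = (\<Sum>(G', b)\<in>I. row_gf (Holed l G' (M + b)) $ (p - ((2 + (G' - G)) + b)))"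
      unfolding B_def using assms
      by (subst sum.reindex)
         (auto simp: inj_on_def Holed row_cost_def I_def simp del: row_gf.simps
            intro!: sum.cong arg_cong[of _ _ "fps_nth _"])
    moreover have "\<dots> = (\<Sum>G'\<in>{G..<M}.
        fps_X ^ (2 + (G' - G)) * shift_sum (\<lambda>M. row_gf (Holed l G' M)) M) $ p"
      unfolding I_def fps_sum_nth fps_nth_X_power_times_shift_sum
      by (rule sum.Sigma[symmetric]) (simp, intro ballI bnd)
    moreover have "(\<Sum>r\<in>A \<union> B. row_gf r $ (p - row_cost s r))
      = (\<Sum>r\<in>A. row_gf r $ (p - row_cost s r)) + (\<Sum>r\<in>B. row_gf r $ (p - row_cost s r))"
      using bnd[of 1] finI by (intro sum.union_disjoint) (auto simp: A_def B_def)
    moreover have "finite (A \<union> B)"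
      using bnd[of 1] finI by (simp add: A_def B_def)
    moreover have "row_gf s = fps_X * shift_sum (\<lambda>M. row_gf (Upper M)) M
      + (\<Sum>G'\<in>{G..<M}. fps_X ^ (2 + (G' - G)) * shift_sum (\<lambda>M. row_gf (Holed l G' M)) M)"
      unfolding Holed by (rule row_gf_Holed)
    moreover have "\<not> is_upper s"
      by (simp add: Holed)
    ultimately show ?thesis
      unfolding steps by (simp del: row_gf.simps)
  next
    case (Lower M)
    define A where "A = (\<lambda>b. Lower (M + b)) ` {b. 1 + b \<le> p}"
    define I where "I = (SIGMA l:{1..<M}. SIGMA G:{Suc l..<M}. {b. (2 + (G - l)) + b \<le> p})"
    define B where "B = (\<lambda>(l, G, b). Holed l G (M + b)) ` I"
    have steps: "{r. row_step s r \<and> row_cost s r \<le> p} = A \<union> B" (is "?R = ?S")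
    proof (intro set_eqI iffI)
      fix r assume r: "r \<in> ?R"
      show "r \<in> ?S"
      proof (cases r)
        case (Holed l G M')
        with r Lower have "r = (\<lambda>(l, G, b). Holed l G (M + b)) (l, G, M' - M)" "(l, G, M' - M) \<in> I"
          by (auto simp: row_cost_def I_def)
        then show ?thesis
          unfolding B_def by blast
      next
        case (Lower M')
        with r \<open>s = _\<close> show ?thesis
          by (auto simp: A_def row_cost_def image_iff intro!: exI[of _ "M' - M"])
      qed (use r Lower in auto)
    qed (auto simp: Lower A_def B_def I_def row_cost_def)
    have finI: "finite I"
      unfolding I_def by (intro finite_SigmaI bnd) simp_all
    have "(\<Sum>r\<in>A. row_gf r $ (p - row_cost s r)) = (fps_X ^ 1 * shift_sum (\<lambda>M. row_gf (Lower M)) M) $ p"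
      unfolding A_def fps_nth_X_power_times_shift_sum
      by (subst sum.reindex) (auto simp: inj_on_def Lower row_cost_def simp del: row_gf.simps)
    moreover have "(\<Sum>r\<in>B. row_gf r $ (p - row_cost s r))
      = (\<Sum>(l, G, b)\<in>I. row_gf (Holed l G (M + b)) $ (p - ((2 + (G - l)) + b)))"
      unfolding B_def
      by (subst sum.reindex)
         (auto simp: inj_on_def Lower row_cost_def I_def simp del: row_gf.simps
            intro!: sum.cong arg_cong[of _ _ "fps_nth _"])
    moreover have "\<dots> = (\<Sum>l\<in>{1..<M}. \<Sum>G\<in>{Suc l..<M}.
        fps_X ^ (2 + (G - l)) * shift_sum (\<lambda>M. row_gf (Holed l G M)) M) $ p"
      unfolding I_def fps_sum_nth fps_nth_X_power_times_shift_sum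
      by (subst sum.Sigma[symmetric], simp, intro ballI finite_SigmaI bnd, simp,
          intro sum.cong refl, rule sum.Sigma[symmetric], simp, intro ballI bnd)
    moreover have "(\<Sum>r\<in>A \<union> B. row_gf r $ (p - row_cost s r))
      = (\<Sum>r\<in>A. row_gf r $ (p - row_cost s r)) + (\<Sum>r\<in>B. row_gf r $ (p - row_cost s r))"
      using bnd[of 1] finI by (intro sum.union_disjoint) (auto simp: A_def B_def)
    moreover have "finite (A \<union> B)"
      using bnd[of 1] finI by (simp add: A_def B_def)
    moreover have "row_gf s = fps_X * shift_sum (\<lambda>M. row_gf (Lower M)) M
      + (\<Sum>l\<in>{1..<M}. \<Sum>G\<in>{Suc l..<M}.
          fps_X ^ (2 + (G - l)) * shift_sum (\<lambda>M. row_gf (Holed l G M)) M)"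
      unfolding Lower by (rule row_gf_Lower) (use assms Lower in simp)
    moreover have "\<not> is_upper s"
      by (simp add: Lower)
    ultimately show ?thesis
      unfolding steps by (simp del: row_gf.simps)
  qed
  then show "finite {r. row_step s r \<and> row_cost s r \<le> p}"
    and "row_gf s $ p = of_bool (is_upper s \<and> p = 0)
      + (\<Sum>r | row_step s r \<and> row_cost s r \<le> p. row_gf r $ (p - row_cost s r))"
    by blast+
qed

abbreviation row_walk :: "row \<Rightarrow> row list \<Rightarrow> bool" where
  "row_walk \<equiv> walk row_step is_upper"

lemma card_row_walks:
  assumes "proper s"
  shows "int (card {rs. row_walk s rs \<and> walk_cost row_cost s rs = p}) = row_gf s $ p"
proof -
  have "0 < row_cost s r" for s r
    by (cases r) (auto simp: row_cost_def)
  then show ?thesis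
    using card_walks_eq_fps_nth[of "Collect proper" row_step row_cost row_gf is_upper s p]
      proper_row_step row_gf_nth assms
    by (auto simp del: row_gf.simps)
qed

text \<open>Width 1 leaves no room for a hole, so the double sum in \<open>row_gf_Lower\<close> is
  empty, and in \<open>lower_gf 1\<close> the first and last terms cancel.\<close>

lemma row_gf_Lower_one: "row_gf (Lower 1) = fps_X ^ 6 * catalan_fps * two_power_fps ^ 4"
proof -
  have "row_gf (Lower 1) = fps_X * (fps_X ^ 4 * two_power_fps\<^sup>2 * lower_gf 1)"
    using row_gf_Lower[of 1] shift_sum_row_gf_Lower[of 1] by (simp del: row_gf.simps)
  also have "lower_gf 1 = fps_X * catalan_fps * two_power_fps\<^sup>2"
    by (simp add: lower_gf_def)
  finally show ?thesis
    by algebra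
qed

section \<open>Boundary of a stack of rows\<close>

definition side_edges :: "int set \<Rightarrow> (int \<times> int) set" where
  "side_edges R = {(x, y). x \<in> R \<and> y \<notin> R \<and> \<bar>x - y\<bar> = 1}"

definition row_diff :: "int set \<Rightarrow> int set \<Rightarrow> int set" where
  "row_diff R S = (R - S) \<union> (S - R)"

lemma finite_side_edges: "finite R \<Longrightarrow> finite (side_edges R)"
  by (rule finite_subset[of _ "R \<times> ((\<lambda>x. x - 1) ` R \<union> (\<lambda>x. x + 1) ` R)"])
     (auto simp: side_edges_def image_iff abs_if split: if_splits, force+)

text \<open>Vertical edges lie within one row; each column of \<open>row_diff\<close> carries one
  horizontal edge between consecutive rows. Row 0 must be empty because \<open>nat\<close> sends
  every negative index to it.\<close>

lemma boundary_length_rows: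
  fixes r :: "nat \<Rightarrow> int set"
  assumes "r 0 = {}" and "\<And>i. N < i \<Longrightarrow> r i = {}" and fin: "\<And>i. finite (r i)"
  shows "boundary_length {(x, i). x \<in> r (nat i)}
    = (\<Sum>i\<le>N. card (side_edges (r i)) + card (row_diff (r i) (r (Suc i))))"
proof -
  define h :: "nat \<times> int \<times> int \<Rightarrow> cell \<times> cell" where
    "h = (\<lambda>(i, x, y). ((x, int i), (y, int i)))"
  \<comment> \<open>A boundary pair lists its inner cell first, so the orientation depends on which
    of the two rows contains \<open>x\<close>.\<close>
  define v :: "nat \<times> int \<Rightarrow> cell \<times> cell" where
    "v = (\<lambda>(i, x). if x \<in> r i then ((x, int i), (x, int i + 1)) else ((x, int i + 1), (x, int i)))"
  define H where "H = (SIGMA i:{..N}. side_edges (r i))"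
  define V where "V = (SIGMA i:{..N}. row_diff (r i) (r (Suc i)))"
  have fin_diff: "finite (row_diff (r i) (r j))" for i j
    using fin by (simp add: row_diff_def)
  have finHV: "finite H" "finite V"
    using fin finite_side_edges fin_diff by (auto simp: H_def V_def)
  have Suc_nat: "nat (int i + 1) = Suc i" for i
    by simp
  have "{(c, d). c \<in> {(x, i). x \<in> r (nat i)} \<and> d \<notin> {(x, i). x \<in> r (nat i)} \<and> adjacent c d}
    = h ` H \<union> v ` V" (is "?B = _")
  proof (intro set_eqI iffI)
    fix e assume "e \<in> ?B"
    then obtain x a y b where e: "e = ((x, a), (y, b))" and x: "x \<in> r (nat a)" and y: "y \<notin> r (nat b)"
      and adj: "\<bar>x - y\<bar> + \<bar>a - b\<bar> = 1"
      by (auto simp: adjacent_def)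
    have a: "0 < a" "nat a \<le> N"
      using x assms(1) assms(2)[of "nat a"] by (cases "0 < a"; force)+
    consider "b = a" "\<bar>x - y\<bar> = 1" | "b = a + 1" "y = x" | "b = a - 1" "y = x"
      using adj by linarith
    then show "e \<in> h ` H \<union> v ` V"
    proof cases
      case 1
      then have "e = h (nat a, x, y)" "(nat a, x, y) \<in> H"
        using a x y by (auto simp: e h_def H_def side_edges_def)
      then show ?thesis
        by blast
    next
      case 2
      then have "e = v (nat a, x)" "(nat a, x) \<in> V"
        using a x y by (auto simp: e v_def V_def row_diff_def Suc_nat_eq_nat_zadd1 add.commute)
      then show ?thesis
        by blast
    next
      case 3
      then have "a = int (nat b) + 1" "nat a = Suc (nat b)"
        using a by auto
      then have "e = v (nat b, x)" "(nat b, x) \<in> V"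
        using a x y 3 by (auto simp: e v_def V_def row_diff_def)
      then show ?thesis
        by blast
    qed
  next
    fix e assume "e \<in> h ` H \<union> v ` V"
    then show "e \<in> ?B"
      by (auto simp: h_def H_def v_def V_def row_diff_def side_edges_def adjacent_def Suc_nat)
  qed
  then have "boundary_length {(x, i). x \<in> r (nat i)} = card (h ` H \<union> v ` V)"
    by (simp add: boundary_length_def)
  also have "\<dots> = card (h ` H) + card (v ` V)"
    by (rule card_Un_disjoint) (use finHV in \<open>auto simp: h_def v_def split: if_splits\<close>)
  also have "card (h ` H) = card H"
    by (rule card_image) (auto simp: inj_on_def h_def)
  also have "card (v ` V) = card V"
    by (rule card_image) (auto simp: inj_on_def v_def split: if_splits)
  also have "card H + card V
    = (\<Sum>i\<le>N. card (side_edges (r i)) + card (row_diff (r i) (r (Suc i))))"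
    using fin finite_side_edges fin_diff by (simp add: H_def V_def sum.distrib)
  finally show ?thesis .
qed

definition stack :: "int set list \<Rightarrow> cell set" where
  "stack Rs = {(x, i). 1 \<le> i \<and> i \<le> int (length Rs) \<and> x \<in> Rs ! (nat i - 1)}"

text \<open>\<open>P\<close> is the row below the list, whose side edges and lower border are
  already accounted for. At the end its upper border remains.\<close>

fun stack_boundary :: "int set \<Rightarrow> int set list \<Rightarrow> nat" where
  "stack_boundary P [] = card P"
| "stack_boundary P (R # Rs) =
     card (row_diff P R) + card (side_edges R) + stack_boundary R Rs"

lemma boundary_length_stack:
  assumes "\<And>R. R \<in> set Rs \<Longrightarrow> finite R"
  shows "boundary_length (stack Rs) = stack_boundary {} Rs"
proof -
  define r where "r Rs i = (if i < length Rs then Rs ! i else {})" for Rs :: "int set list" and i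
  have r_Cons: "r (P # Rs) (Suc i) = r Rs i" "r (P # Rs) 0 = P" for P Rs i
    by (auto simp: r_def)
  have sum: "(\<Sum>i\<le>length Rs. card (side_edges (r (P # Rs) i))
      + card (row_diff (r (P # Rs) i) (r (P # Rs) (Suc i))))
    = card (side_edges P) + stack_boundary P Rs" for P and Rs
  proof (induction Rs arbitrary: P)
    case Nil
    then show ?case
      by (simp add: r_def row_diff_def)
  next
    case (Cons R Rs)
    from Cons[of R] show ?case
      by (simp add: sum.atMost_Suc_shift r_Cons del: sum.atMost_Suc)
  qed
  have "stack Rs = {(x, i). x \<in> r ({} # Rs) (nat i)}"
    by (auto simp: stack_def r_def nth_Cons' split: if_splits)
  moreover have "boundary_length {(x, i). x \<in> r ({} # Rs) (nat i)}
    = (\<Sum>i\<le>length Rs. card (side_edges (r ({} # Rs) i))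
        + card (row_diff (r ({} # Rs) i) (r ({} # Rs) (Suc i))))"
    by (rule boundary_length_rows) (use assms in \<open>auto simp: r_def nth_Cons'\<close>)
  ultimately show ?thesis
    unfolding sum by (simp add: side_edges_def)
qed

text \<open>Nonempty rows make the height visible in the cells, and each row is a horizontal
  slice.\<close>

lemma stack_inject:
  assumes "stack Rs = stack Ss" and "{} \<notin> set Rs" and "{} \<notin> set Ss"
  shows "Rs = Ss"
proof -
  have sub: "length Rs \<le> length Ss" if "stack Rs = stack Ss" "{} \<notin> set Rs" for Rs Ss
  proof (cases Rs rule: rev_cases)
    case (snoc Rs' R)
    with that(2) obtain x where "x \<in> R"
      by fastforce
    then have "(x, int (length Rs)) \<in> stack Rs"
      by (auto simp: stack_def snoc nat_add_distrib)
    then show ?thesis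
      unfolding that(1) by (auto simp: stack_def)
  qed simp
  have nth: "R = {x. (x, int (Suc i)) \<in> stack Rs}" if "i < length Rs" "Rs ! i = R" for i R Rs
    using that by (auto simp: stack_def nat_add_distrib)
  have "length Rs = length Ss"
    using sub assms by (metis order_antisym)
  then show ?thesis
    using assms(1) nth[of _ Rs, OF _ refl] nth[of _ Ss, OF _ refl] by (metis nth_equalityI)
qed

section \<open>Diagrams as walks\<close>

fun columns :: "row \<Rightarrow> int set" where
  "columns (Lower M) = {1..int M}"
| "columns (Holed l G M) = {1..int l} \<union> {int G + 1..int M}"
| "columns (Upper M) = {1..int M}"

lemma finite_columns: "finite (columns r)"
  by (cases r) auto

text \<open>Each component has a left and a right edge. Even around a hole one column wide they
  differ, since their inner cells do.\<close>

lemma card_side_edges_columns: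
  assumes "proper r"
  shows "card (side_edges (columns r)) = 2 * components r"
proof -
  have full: "side_edges {1..int M} = {(1, 0), (int M, int M + 1)}" if "1 \<le> M" for M
    using that by (auto simp: side_edges_def)
  show ?thesis
  proof (cases r)
    case (Holed l G M)
    then have "side_edges (columns r)
      = {(1, 0), (int l, int l + 1), (int G + 1, int G), (int M, int M + 1)}"
      using assms by (auto simp: side_edges_def)
    with Holed assms show ?thesis
      by auto
  qed (use full assms in auto)
qed

text \<open>The cost counts each column of width or gap once, when it appears, although it gives two
  horizontal edges. The potential \<open>width + gap\<close> records the second edges still due, so
  the identity telescopes along a walk. It is written additively to avoid truncated
  subtraction.\<close>

lemma card_row_diff_columns:
  assumes "proper s" "row_step s r"
  shows "card (row_diff (columns s) (columns r)) + 2 * components r + width r + gap r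
    = 2 * row_cost s r + width s + gap s"
proof -
  have full: "row_diff {1..int M} {1..int M'} = {int M + 1..int M'}" if "M \<le> M'" for M M'
    using that by (auto simp: row_diff_def)
  show ?thesis
  proof (cases s)
    case (Lower M)
    show ?thesis
    proof (cases r)
      case (Holed l G M')
      then have "row_diff (columns s) (columns r) = {int l + 1..int G} \<union> {int M + 1..int M'}"
        using assms Lower by (auto simp: row_diff_def)
      moreover have "card ({int l + 1..int G} \<union> {int M + 1..int M'}) = (G - l) + (M' - M)"
        using assms Lower Holed by (subst card_Un_disjoint) auto
      ultimately show ?thesis
        using assms Lower Holed by (auto simp: row_cost_def)
    qed (use assms Lower full in \<open>auto simp: row_cost_def\<close>)
  next
    case (Holed l G M)
    show ?thesis
    proof (cases r)
      case (Holed l' G' M')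
      then have "row_diff (columns s) (columns r) = {int G + 1..int G'} \<union> {int M + 1..int M'}"
        using assms \<open>s = _\<close> by (auto simp: row_diff_def)
      moreover have "card ({int G + 1..int G'} \<union> {int M + 1..int M'}) = (G' - G) + (M' - M)"
        using assms \<open>s = _\<close> Holed by (subst card_Un_disjoint) auto
      ultimately show ?thesis
        using assms \<open>s = _\<close> Holed by (auto simp: row_cost_def)
    next
      case (Upper M')
      then have "row_diff (columns s) (columns r) = {int l + 1..int G} \<union> {int M + 1..int M'}"
        using assms Holed by (auto simp: row_diff_def)
      moreover have "card ({int l + 1..int G} \<union> {int M + 1..int M'}) = (G - l) + (M' - M)"
        using assms Holed Upper by (subst card_Un_disjoint) auto
      ultimately show ?thesis
        using assms Holed Upper by (auto simp: row_cost_def)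
    qed (use assms Holed in auto)
  next
    case (Upper M)
    with assms full show ?thesis
      by (cases r) (auto simp: row_cost_def)
  qed
qed

lemma stack_boundary_row_walk:
  assumes "row_walk s rs" "proper s"
  shows "stack_boundary (columns s) (map columns rs)
    = 2 * walk_cost row_cost s rs + width s + gap s"
  using assms
proof (induction rs arbitrary: s)
  \<comment> \<open>A final row is full, so its gap is 0 and its upper border has
    \<open>width s\<close> edges.\<close>
  case Nil
  then show ?case
    by (cases s) auto
next
  case (Cons r rs)
  then have "row_step s r" "proper r"
    using proper_row_step by auto
  then show ?case
    using Cons card_row_diff_columns[of s r] card_side_edges_columns[of r] by simp
qed

definition diagram :: "row list \<Rightarrow> cell set" where
  "diagram rs = stack (map columns rs)"

text \<open>The start \<open>Lower 1\<close> is a virtual row below the diagram. Replacing the empty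
  row by it removes the one edge under column 1, while its potential adds 1; together they make the
  2 behind the \<open>Suc\<close>.\<close>

lemma half_perimeter_diagram:
  assumes "row_walk (Lower 1) rs"
  shows "half_perimeter (diagram rs) = real (Suc (walk_cost row_cost (Lower 1) rs))"
proof -
  obtain r rs' where rs: "rs = r # rs'" and step: "row_step (Lower 1) r"
    using assms by (cases rs) auto
  have "proper r"
    using proper_row_step[OF _ step] by simp
  then have "1 \<in> columns r"
    by (cases r) auto
  then have "row_diff {} (columns r) = insert 1 (row_diff {1} (columns r))"
            "1 \<notin> row_diff {1} (columns r)"
    by (auto simp: row_diff_def)
  then have "card (row_diff {} (columns r)) = Suc (card (row_diff {1} (columns r)))"
    using finite_columns[of r] by (metis card_insert_disjoint finite_Diff finite_Un finite.intros row_diff_def)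
  then have "stack_boundary {} (map columns rs)
      = Suc (stack_boundary (columns (Lower 1)) (map columns rs))"
    by (simp add: rs)
  also have "\<dots> = 2 * Suc (walk_cost row_cost (Lower 1) rs)"
    using stack_boundary_row_walk[OF assms] by simp
  finally have "boundary_length (diagram rs) = 2 * Suc (walk_cost row_cost (Lower 1) rs)"
    unfolding diagram_def using finite_columns by (subst boundary_length_stack) auto
  then show ?thesis
    by (simp add: half_perimeter_def)
qed

section \<open>Walks are recovered from their cells\<close>

lemma row_walk_proper:
  "row_walk s rs \<Longrightarrow> proper s \<Longrightarrow> r \<in> set rs \<Longrightarrow> proper r"
  by (induction rs arbitrary: s) (auto dest: proper_row_step)

lemma columns_full_neq_holed:
  assumes "proper (Holed l G M)"
  shows "{1..int K} \<noteq> columns (Holed l G M)"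
proof
  assume "{1..int K} = columns (Holed l G M)"
  then have "int M \<in> {1..int K}" "int G \<notin> {1..int K}"
    using assms by auto
  with assms show False
    by auto
qed

lemma columns_holed_inject:
  assumes "proper (Holed l G M)" "proper (Holed l' G' M')"
    and "columns (Holed l G M) = columns (Holed l' G' M')"
  shows "Holed l G M = Holed l' G' M'"
proof -
  have "l \<le> l' \<and> M \<le> M'" if "proper (Holed l G M)" "proper (Holed l' G' M')"
    "columns (Holed l G M) = columns (Holed l' G' M')" for l G M l' G' M'
  proof -
    have mem: "x \<in> columns (Holed l G M) \<longleftrightarrow> x \<in> columns (Holed l' G' M')" for x
      using that(3) by simp
    show ?thesis
      \<comment> \<open>Column \<open>l' + 1\<close> lies in the second hole, which bounds
        \<open>l\<close>; column \<open>M\<close> is the last of the first row, which bounds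
        \<open>M\<close>.\<close>
      using that(1,2) mem[of "int l' + 1"] mem[of "int M"] by auto
  qed
  from this[OF assms] this[OF assms(2,1) assms(3)[symmetric]] have eq: "l = l'" "M = M'"
    by auto
  have mem: "x \<in> columns (Holed l G M) \<longleftrightarrow> x \<in> columns (Holed l' G' M')" for x
    using assms(3) by simp
  have "\<not> G < G'" "\<not> G' < G"
    using assms(1,2) mem[of "int G + 1"] mem[of "int G' + 1"] by (auto simp: eq)
  with eq show ?thesis
    by simp
qed

text \<open>\<open>Lower M\<close> and \<open>Upper M\<close> have the same columns, but no row has
  steps to both kinds. Hence the common predecessor is needed.\<close>

lemma columns_inject_step:
  assumes "proper s" "row_step s r" "row_step s r'" "columns r = columns r'"
  shows "r = r'"
proof -
  have proper: "proper r" "proper r'"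
    using assms proper_row_step by blast+
  show ?thesis
  proof (cases "\<exists>l G M. r = Holed l G M")
    case True
    then obtain l G M where r: "r = Holed l G M"
      by blast
    then obtain l' G' M' where "r' = Holed l' G' M'"
      using proper assms(4) columns_full_neq_holed[of l G M] by (cases r') auto
    with r show ?thesis
      using proper assms(4) columns_holed_inject by blast
  next
    case False
    then have full: "columns r = {1..int (width r)}"
      by (cases r) auto
    then have "\<nexists>l G M. r' = Holed l G M"
      using proper assms(4) columns_full_neq_holed by metis
    then have "columns r' = {1..int (width r')}"
      by (cases r') auto
    with full assms(4) have "width r = width r'"
      using proper by (cases r; cases r') auto
    with False \<open>\<nexists>l G M. r' = _ l G M\<close> assms(2,3) show ?thesis
      by (cases s; cases r; cases r') auto
  qed
qed

lemma map_columns_inject: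
  assumes "row_walk s rs" "row_walk s rs'" "proper s" "map columns rs = map columns rs'"
  shows "rs = rs'"
  using assms
proof (induction rs arbitrary: s rs')
  case (Cons r rs)
  then obtain r' rs'' where "rs' = r' # rs''"
    by auto
  with Cons show ?case
    using columns_inject_step[of s r r'] proper_row_step[of s r] by auto
qed simp

lemma inj_on_diagram: "inj_on diagram {rs. row_walk (Lower 1) rs}"
proof (rule inj_onI, clarsimp simp: diagram_def)
  fix rs rs' assume walks: "row_walk (Lower (Suc 0)) rs" "row_walk (Lower (Suc 0)) rs'"
    and eq: "stack (map columns rs) = stack (map columns rs')"
  have ne: "columns r \<noteq> {}" if "proper r" for r
    using that by (cases r) auto
  have "{} \<notin> columns ` set rs" "{} \<notin> columns ` set rs'"
    using ne row_walk_proper walks by (metis One_nat_def imageE order_refl proper.simps(1))+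
  then have "map columns rs = map columns rs'"
    using stack_inject[OF eq] by simp
  then show "rs = rs'"
    using map_columns_inject walks by simp
qed

section \<open>Walks from the virtual row are exactly the wicketed diagrams\<close>

lemma wicketed_ferrers_imp_diagram:
  assumes "wicketed_ferrers D"
  shows "\<exists>rs. row_walk (Lower 1) rs \<and> D = diagram rs"
proof -
  obtain j n N l m g where jnN: "1 \<le> j" "j < n" "n < N" "1 \<le> l"
    and m: "1 \<le> m 1" "\<And>i. 1 \<le> i \<Longrightarrow> i < N \<Longrightarrow> m i \<le> m (i + 1)"
    and lg: "\<And>i. j < i \<Longrightarrow> i \<le> n \<Longrightarrow> l < g i \<and> g i < m i"
    and gj: "g (j + 1) < m j"
    and g: "\<And>i. j < i \<Longrightarrow> i < n \<Longrightarrow> g i \<le> g (i + 1) \<and> g (i + 1) < m i"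
    and D: "D = wicketed_cells j n N l m g"
    using assms unfolding wicketed_ferrers_def by blast
  \<comment> \<open>Positivity makes the conversions by \<open>nat\<close> below faithful.\<close>
  have m_pos: "1 \<le> m i" if "1 \<le> i" "i \<le> N" for i
    using that by (induction i rule: int_ge_induct) (use m in force)+
  define row_at where "row_at k = (let i = int k in
      if i \<le> j then Lower (nat (m i))
      else if i \<le> n then Holed (nat l) (nat (g i)) (nat (m i))
      else Upper (nat (m i)))" for k
  define rs where "rs = map row_at [1..<Suc (nat N)]"
  have len: "length rs = nat N"
    by (simp add: rs_def)
  have nth: "rs ! k = row_at (Suc k)" if "k < nat N" for k
    using that by (simp add: rs_def del: upt_Suc)
  have step: "row_step (row_at k) (row_at (Suc k))" if "0 < k" "k < nat N" for k
  proof -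
    define i where "i = int k"
    have i: "1 \<le> i" "i < N" "int (Suc k) = i + 1"
      using that by (auto simp: i_def)
    have "1 \<le> m i" "m i \<le> m (i + 1)"
      using m_pos[of i] m(2)[of i] i by auto
    consider "i < j" | "i = j" | "j < i" "i < n" | "i = n" | "n < i"
      by linarith
    then show ?thesis
      using lg[of i] lg[of "i + 1"] g[of i] gj jnN \<open>1 \<le> m i\<close> \<open>m i \<le> m (i + 1)\<close>
      unfolding row_at_def Let_def i(3) i_def[symmetric] by cases auto
  qed
  have "row_walk (Lower 1) rs"
    unfolding walk_iff_nth
  proof (intro conjI allI impI)
    fix k assume k: "k < length rs"
    show "row_step ((Lower 1 # rs) ! k) (rs ! k)"
    proof (cases k)
      case 0
      then show ?thesis
        using k jnN m(1) by (simp add: len nth row_at_def)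
    next
      case (Suc k')
      then show ?thesis
        using k step[of k] by (simp add: len nth)
    qed
  next
    obtain K where K: "nat N = Suc K" "int (Suc K) = N"
      using jnN by (cases "nat N") auto
    then show "is_upper ((Lower 1 # rs) ! length rs)"
      using jnN nth[of K] by (simp add: len row_at_def)
  qed
  moreover have "D = diagram rs"
  proof (rule set_eqI)
    fix c :: cell
    obtain x i where c: "c = (x, i)"
      by fastforce
    show "c \<in> D \<longleftrightarrow> c \<in> diagram rs"
    proof (cases "1 \<le> i \<and> i \<le> N")
      case True
      then have "nat i - 1 < nat N" "Suc (nat i - 1) = nat i"
        by auto
      then have "map columns rs ! (nat i - 1) = columns (row_at (nat i))"
        using nth by (simp add: len)
      with True show ?thesis
        using m_pos[of i] lg[of i] jnN
        by (auto simp: c D diagram_def stack_def wicketed_cells_def len row_at_def)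
    next
      case False
      then show ?thesis
        by (auto simp: c D diagram_def stack_def wicketed_cells_def len)
    qed
  qed
  ultimately show ?thesis
    by blast
qed

text \<open>Locates the last row below the hole and the last row of the hole, the numbers
  \<open>j\<close> and \<open>n\<close> of a diagram.\<close>

lemma ex_threshold:
  assumes "P (0::nat)" "\<not> P N" "\<And>i. i < N \<Longrightarrow> P (Suc i) \<Longrightarrow> P i"
  obtains k where "k < N" "\<And>i. i \<le> N \<Longrightarrow> P i \<longleftrightarrow> i \<le> k"
proof -
  have down: "P i" if "P k" "i \<le> k" "k \<le> N" for i k
    using that by (induction k) (auto simp: le_Suc_eq assms(3))
  define k where "k = (GREATEST i. i \<le> N \<and> P i)"
  have k: "k \<le> N \<and> P k"
    unfolding k_def by (rule GreatestI_nat[of _ 0 N]) (use assms(1) in auto)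
  have "i \<le> k" if "i \<le> N" "P i" for i
    unfolding k_def by (rule Greatest_le_nat[of _ _ N]) (use that in auto)
  moreover have "k < N"
    using k assms(2) by (cases "k = N") auto
  ultimately show thesis
    using that k down by blast
qed

fun hole_start :: "row \<Rightarrow> nat" where
  "hole_start (Holed l G M) = l"
| "hole_start _ = 0"

fun hole_end :: "row \<Rightarrow> nat" where
  "hole_end (Holed l G M) = G"
| "hole_end _ = 0"

fun is_lower :: "row \<Rightarrow> bool" where
  "is_lower (Lower M) \<longleftrightarrow> True"
| "is_lower _ \<longleftrightarrow> False"

lemma wicketed_ferrers_diagram:
  assumes walk: "row_walk (Lower 1) rs"
  shows "wicketed_ferrers (diagram rs)"
proof -
  \<comment> \<open>Index 0 is the virtual row, so for positive \<open>i\<close> the value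
    \<open>r i\<close> is row \<open>i\<close> of the diagram.\<close>
  define r where "r = (\<lambda>i. (Lower 1 # rs) ! i)"
  define N where "N = length rs"
  have r0: "r 0 = Lower 1"
    by (simp add: r_def)
  have steps: "row_step (r i) (r (Suc i))" if "i < N" for i
    using walk that by (simp add: walk_iff_nth r_def N_def)
  have last: "is_upper (r N)"
    using walk by (simp add: walk_iff_nth r_def N_def)
  have proper: "proper (r i)" if "i \<le> N" for i
    using that row_walk_proper[OF walk] by (cases i) (auto simp: r_def N_def)
  obtain j where j: "j < N" "\<And>i. i \<le> N \<Longrightarrow> is_lower (r i) \<longleftrightarrow> i \<le> j"
  proof (rule ex_threshold[of "\<lambda>i. is_lower (r i)" N])
    show "\<not> is_lower (r N)"
      using last by (cases "r N") auto
    show "is_lower (r i)" if "i < N" "is_lower (r (Suc i))" for i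
      using steps[of i] that by (cases "r i"; cases "r (Suc i)") auto
  qed (auto simp: r0)
  obtain n where n: "n < N" "\<And>i. i \<le> N \<Longrightarrow> \<not> is_upper (r i) \<longleftrightarrow> i \<le> n"
  proof (rule ex_threshold[of "\<lambda>i. \<not> is_upper (r i)" N])
    show "\<not> is_upper (r i)" if "i < N" "\<not> is_upper (r (Suc i))" for i
      using steps[of i] that by (cases "r i"; cases "r (Suc i)") auto
  qed (auto simp: r0 last)
  define l where "l = hole_start (r (Suc j))"
  have lower: "r i = Lower (width (r i))" if "i \<le> j" for i
    using j(1) j(2)[of i] that by (cases "r i") auto
  have upper: "r i = Upper (width (r i))" if "n < i" "i \<le> N" for i
    using n(2)[of i] that by (cases "r i") auto
  \<comment> \<open>Otherwise row \<open>j\<close> would step directly from \<open>Lower\<close> to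
    \<open>Upper\<close>.\<close>
  have "j < n"
  proof (rule ccontr)
    assume "\<not> j < n"
    then show False
      using steps[of j] lower[of j] upper[of "Suc j"] j(1) by (cases "r j"; cases "r (Suc j)") auto
  qed
  \<comment> \<open>Steps between holed rows keep the left end of the hole, so the value at row
    \<open>Suc j\<close> serves for all of them.\<close>
  have holed: "r i = Holed l (hole_end (r i)) (width (r i))" if "j < i" "i \<le> n" for i
    using Suc_leI[OF that(1)] that(2)
  proof (induction i rule: dec_induct)
    case base
    then show ?case
      using j(2)[of "Suc j"] n(2)[of "Suc j"] n(1) by (cases "r (Suc j)") (auto simp: l_def)
  next
    case (step i)
    then show ?case
      using j(2)[of "Suc i"] n(2)[of "Suc i"] n(1) steps[of i]
      by (cases "r (Suc i)"; cases "r i") auto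
  qed
  have hole: "1 \<le> l \<and> l < hole_end (r i) \<and> hole_end (r i) < width (r i)" if "j < i" "i \<le> n" for i
    using proper[of i] holed[of i] n(1) that by (metis less_imp_le order_trans proper.simps(2))
  have hole_top: "hole_end (r i) \<le> hole_end (r (Suc i)) \<and> hole_end (r (Suc i)) < width (r i)"
    if "j < i" "i < n" for i
    using steps[of i] holed[of i] holed[of "Suc i"] n(1) that
    by (cases "r i"; cases "r (Suc i)") auto
  have hole_bottom: "hole_end (r (Suc j)) < width (r j)"
    using steps[of j] lower[of j] holed[of "Suc j"] j(1) \<open>j < n\<close>
    by (cases "r j"; cases "r (Suc j)") auto
  have mono: "width (r i) \<le> width (r (Suc i))" if "i < N" for i
    using steps[OF that] by (cases "r i"; cases "r (Suc i)") auto
  \<comment> \<open>For \<open>j = 0\<close> the hole would have to lie over the virtual row, which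
    has width 1.\<close>
  have "1 \<le> j"
    using hole_bottom hole[of "Suc j"] \<open>j < n\<close> r0 by (cases j) auto
  define m where "m i = int (width (r (nat i)))" for i
  define g where "g i = int (hole_end (r (nat i)))" for i
  have "diagram rs = wicketed_cells (int j) (int n) (int N) (int l) m g"
  proof (rule set_eqI)
    fix c :: cell
    obtain x i where c: "c = (x, i)"
      by fastforce
    show "c \<in> diagram rs \<longleftrightarrow> c \<in> wicketed_cells (int j) (int n) (int N) (int l) m g"
    proof (cases "1 \<le> i \<and> i \<le> int N")
      case True
      define k where "k = nat i"
      have k: "1 \<le> k" "k \<le> N" "i = int k"
        using True by (auto simp: k_def)
      then have nth: "map columns rs ! (nat i - 1) = columns (r k)"
        by (auto simp: r_def N_def nth_Cons')
      have "columns (r k) = (if j < k \<and> k \<le> n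
          then {1..int l} \<union> {g i + 1..m i} else {1..m i})"
        using lower[of k] holed[of k] upper[of k] k by (cases "r k") (auto simp: m_def g_def)
      with k nth show ?thesis
        by (auto simp: c diagram_def stack_def wicketed_cells_def N_def)
    next
      case False
      then show ?thesis
        by (auto simp: c diagram_def stack_def wicketed_cells_def N_def)
    qed
  qed
  moreover have "m i \<le> m (i + 1)" if "1 \<le> i" "i < int N" for i
    using that mono[of "nat i"] by (simp add: m_def nat_add_distrib)
  moreover have "int l < g i \<and> g i < m i" if "int j < i" "i \<le> int n" for i
    using that hole[of "nat i"] by (simp add: m_def g_def)
  moreover have "g i \<le> g (i + 1) \<and> g (i + 1) < m i" if "int j < i" "i < int n" for i
    using that hole_top[of "nat i"] by (simp add: m_def g_def nat_add_distrib)
  moreover have "g (int j + 1) < m (int j)"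
    using hole_bottom by (simp add: m_def g_def nat_add_distrib)
  moreover have "1 \<le> m 1"
    using mono[of 0] r0 n(1) by (simp add: m_def)
  moreover have "1 \<le> int l"
    using hole[of "Suc j"] \<open>j < n\<close> by simp
  ultimately show ?thesis
    unfolding wicketed_ferrers_def using \<open>1 \<le> j\<close> \<open>j < n\<close> n(1)
    by (intro exI[of _ "int j"] exI[of _ "int n"] exI[of _ "int N"] exI[of _ "int l"]
          exI[of _ m] exI[of _ g]) auto
qed

section \<open>The series of diagrams and its quadratic equation\<close>

lemma wicketed_gf_eq: "wicketed_gf = fps_X * row_gf (Lower 1)"
proof (rule fps_ext)
  fix p
  have set_eq: "{D. wicketed_ferrers D \<and> half_perimeter D = real p}
    = diagram ` {rs. row_walk (Lower 1) rs \<and> Suc (walk_cost row_cost (Lower 1) rs) = p}"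
    (is "?L = ?R")
  proof (intro equalityI subsetI)
    fix D assume "D \<in> ?L"
    then obtain rs where rs: "row_walk (Lower 1) rs" "D = diagram rs" "half_perimeter D = real p"
      using wicketed_ferrers_imp_diagram by blast
    then have "Suc (walk_cost row_cost (Lower 1) rs) = p"
      using half_perimeter_diagram[OF rs(1)] by (simp only: of_nat_eq_iff)
    with rs show "D \<in> ?R"
      by blast
  qed (use wicketed_ferrers_diagram half_perimeter_diagram in blast)
  have "wicketed_count p
    = card {rs. row_walk (Lower 1) rs \<and> Suc (walk_cost row_cost (Lower 1) rs) = p}"
    unfolding wicketed_count_def set_eq
    by (rule card_image, rule inj_on_subset[OF inj_on_diagram]) auto
  \<comment> \<open>The factor \<open>fps_X\<close> accounts for the \<open>Suc\<close>; at
    \<open>p = 0\<close> both sides vanish.\<close>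
  moreover have "int (card {rs. row_walk (Lower 1) rs \<and> Suc (walk_cost row_cost (Lower 1) rs) = p})
    = (fps_X * row_gf (Lower 1)) $ p"
    using card_row_walks[of "Lower 1" "p - 1"] by (cases p) (simp_all del: row_gf.simps)
  ultimately show "wicketed_gf $ p = (fps_X * row_gf (Lower 1)) $ p"
    by (simp add: wicketed_gf_def del: row_gf.simps)
qed

theorem theorem2:
  shows "(2 * fps_X - 1) ^ 8 * wicketed_gf\<^sup>2
           - fps_X ^ 6 * (2 * fps_X - 1) ^ 4 * wicketed_gf + fps_X ^ 14 = 0"
proof -
  have "(2 * fps_X - 1) * two_power_fps = -1"
    using two_power_fps_eq by algebra
  \<comment> \<open>The even exponent removes the sign of \<open>-1\<close>.\<close>
  then have inv: "(2 * fps_X - 1) ^ 4 * two_power_fps ^ 4 = 1"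
    by (metis power_mult_distrib power_minus_even power_one even_numeral)
  have gf: "wicketed_gf = fps_X ^ 7 * catalan_fps * two_power_fps ^ 4"
    unfolding wicketed_gf_eq row_gf_Lower_one by algebra
  have "(2 * fps_X - 1) ^ 4 * wicketed_gf
      = fps_X ^ 7 * catalan_fps * ((2 * fps_X - 1) ^ 4 * two_power_fps ^ 4)"
    unfolding gf by (simp only: ac_simps)
  then have eq: "(2 * fps_X - 1) ^ 4 * wicketed_gf = fps_X ^ 7 * catalan_fps"
    by (simp only: inv mult_1_right)
  have "(2 * fps_X - 1) ^ 8 * wicketed_gf\<^sup>2
      - fps_X ^ 6 * (2 * fps_X - 1) ^ 4 * wicketed_gf + fps_X ^ 14
    = ((2 * fps_X - 1) ^ 4 * wicketed_gf)\<^sup>2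
      - fps_X ^ 6 * ((2 * fps_X - 1) ^ 4 * wicketed_gf) + fps_X ^ 14"
    by (simp add: power_mult_distrib mult.assoc flip: power_mult)
  \<comment> \<open>Both powers of \<open>2 * fps_X - 1\<close> are absorbed by \<open>eq\<close>;
    what remains is the equation of \<open>catalan_fps\<close> times
    \<open>fps_X ^ 13\<close>.\<close>
  also have "\<dots> = fps_X ^ 13 * (fps_X + fps_X * catalan_fps\<^sup>2 - catalan_fps)"
    unfolding eq by (simp add: algebra_simps power_mult_distrib
        flip: power_mult power_add power_Suc power_Suc2)
  finally show ?thesis
    using catalan_fps_eq by simp
qed

end
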